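(* Let $(E,\mathcal{E})$ be a Lusin space. Let $(X_n)$ be a (homogeneous) Markov chain with state space $(E,\mathcal{E})$ and with transition kernel $\nu$. Let $L$ be the Markov operator on $\mathcal{L}^\infty(E)$ associated to $\nu$: $$Lf(x)=\int_E f(y)\,\nu(x,dy).$$ Then the Markov chain $(X_n)$ is deterministic if and only if $L$ is a $*$-homomorphism of the algebra $\mathcal{L}^\infty(E)$.
   Context: A Lusin space is a measurable space isomorphic, as a measurable space, to a Borel subset of a compact metrizable space. $\mathcal{L}^\infty(E)$ is the $*$-algebra of bounded measurable complex-valued functions on $E$ with pointwise product and complex conjugation as involution. A $*$-homomorphism is a linear map $L$ with $L(fg)=L(f)L(g)$ and $L(\overline f)=\overline{L(f)}$. A Markov kernel on $(E,\mathcal{E})$ is a map $\nu:E\times\mathcal{E}\to[0,1]$ measurable in the first variable and a probability measure in the second. A homogeneous Markov chain with transition kernel $\nu$ is a discrete-time $E$-valued process with $\mathbb{E}[f(X_{n+1})\mid X_0,\dots,X_n]=Lf(X_n)$ for all bounded measurable $f$ and all $n$. The kernel $\nu$, and a Markov chain with kernel $\nu$, is called deterministic if for every $x\in E$ the measure $\nu(x,\cdot)$ is a Dirac mass, i.e. there is a measurable map $\widetilde T:E\to E$ with $\nu(x,dy)=\delta_{\widetilde T(x)}(dy)$ for all $x\in E$. *)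

theory Defs
  imports "HOL-Probability.Probability"
begin

text \<open>
  A measurable space is a value \<open>E :: 'a measure\<close> of which only \<open>space E\<close> and \<open>sets E\<close> are used.
\<close>

definition borel_of :: "'k topology \<Rightarrow> 'k measure" where
  "borel_of K = sigma (topspace K) {U. openin K U}"

definition measurable_isomorphic :: "'a measure \<Rightarrow> 'b measure \<Rightarrow> bool" where
  "measurable_isomorphic M N \<longleftrightarrow>
     (\<exists>f \<in> M \<rightarrow>\<^sub>M N. \<exists>g \<in> N \<rightarrow>\<^sub>M M.
        (\<forall>x\<in>space M. g (f x) = x) \<and> (\<forall>y\<in>space N. f (g y) = y))"

text \<open>
  HOL cannot quantify existentially over the type of points of the compact space, so that type is
  a parameter. A theorem assuming \<open>lusin_space TYPE('k) E\<close> for a type variable \<open>'k\<close> covers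
  compact metrizable spaces over every type.
\<close>

definition lusin_space :: "'k itself \<Rightarrow> 'a measure \<Rightarrow> bool" where
  "lusin_space _ E \<longleftrightarrow>
     (\<exists>(K :: 'k topology) B. compact_space K \<and> metrizable_space K \<and> B \<in> sets (borel_of K) \<and>
        measurable_isomorphic E (restrict_space (borel_of K) B))"

text \<open>
  Elements of \<open>Linfty E\<close> are functions on \<open>space E\<close>. They are made \<open>extensional\<close>, so that
  equality in HOL is equality at every point of \<open>space E\<close> (no null sets are factored out).
\<close>

definition Linfty :: "'a measure \<Rightarrow> ('a \<Rightarrow> complex) set" where
  "Linfty E = {f \<in> borel_measurable E. f \<in> extensional (space E) \<and> bounded (f ` space E)}"

definition star_hom :: "'a measure \<Rightarrow> (('a \<Rightarrow> complex) \<Rightarrow> ('a \<Rightarrow> complex)) \<Rightarrow> bool" where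
  "star_hom E L \<longleftrightarrow>
     L \<in> Linfty E \<rightarrow> Linfty E \<and>
     (\<forall>f\<in>Linfty E. \<forall>g\<in>Linfty E. L (\<lambda>x\<in>space E. f x + g x) = (\<lambda>x\<in>space E. L f x + L g x)) \<and>
     (\<forall>c. \<forall>f\<in>Linfty E. L (\<lambda>x\<in>space E. c * f x) = (\<lambda>x\<in>space E. c * L f x)) \<and>
     (\<forall>f\<in>Linfty E. \<forall>g\<in>Linfty E. L (\<lambda>x\<in>space E. f x * g x) = (\<lambda>x\<in>space E. L f x * L g x)) \<and>
     (\<forall>f\<in>Linfty E. L (\<lambda>x\<in>space E. cnj (f x)) = (\<lambda>x\<in>space E. cnj (L f x)))"

text \<open>
  A Markov kernel on \<open>E\<close> is a measurable map \<open>\<nu> \<in> E \<rightarrow>\<^sub>M prob_algebra E\<close>; the measure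
  \<open>\<nu>(x, \<cdot>)\<close> is \<open>\<nu> x\<close>.
\<close>

definition markov_op ::
    "'a measure \<Rightarrow> ('a \<Rightarrow> 'a measure) \<Rightarrow> ('a \<Rightarrow> complex) \<Rightarrow> ('a \<Rightarrow> complex)" where
  "markov_op E \<nu> f = (\<lambda>x\<in>space E. \<integral>y. f y \<partial>\<nu> x)"

definition deterministic :: "'a measure \<Rightarrow> ('a \<Rightarrow> 'a measure) \<Rightarrow> bool" where
  "deterministic E \<nu> \<longleftrightarrow> (\<exists>T \<in> E \<rightarrow>\<^sub>M E. \<forall>x\<in>space E. \<nu> x = return E (T x))"

definition complex_cond_exp ::
    "'w measure \<Rightarrow> 'w measure \<Rightarrow> ('w \<Rightarrow> complex) \<Rightarrow> ('w \<Rightarrow> complex)" where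
  "complex_cond_exp M F f =
     (\<lambda>\<omega>. Complex (real_cond_exp M F (\<lambda>\<omega>. Re (f \<omega>)) \<omega>) (real_cond_exp M F (\<lambda>\<omega>. Im (f \<omega>)) \<omega>))"

definition past_algebra ::
    "'w measure \<Rightarrow> 'a measure \<Rightarrow> (nat \<Rightarrow> 'w \<Rightarrow> 'a) \<Rightarrow> nat \<Rightarrow> 'w measure" where
  "past_algebra M E X n = sigma (space M) (\<Union>i\<le>n. {X i -` A \<inter> space M |A. A \<in> sets E})"

definition markov_chain ::
    "'w measure \<Rightarrow> 'a measure \<Rightarrow> ('a \<Rightarrow> 'a measure) \<Rightarrow> (nat \<Rightarrow> 'w \<Rightarrow> 'a) \<Rightarrow> bool" where
  "markov_chain M E \<nu> X \<longleftrightarrow>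
     prob_space M \<and> \<nu> \<in> E \<rightarrow>\<^sub>M prob_algebra E \<and> (\<forall>n. X n \<in> M \<rightarrow>\<^sub>M E) \<and>
     (\<forall>n. \<forall>f\<in>Linfty E. AE \<omega> in M.
        complex_cond_exp M (past_algebra M E X n) (\<lambda>\<omega>. f (X (Suc n) \<omega>)) \<omega> = markov_op E \<nu> f (X n \<omega>))"

end

theory Submission
  imports Defs
begin

text \<open>
  Applied to indicators, multiplicativity of \<open>L\<close> gives \<open>\<nu>(x, A) = \<nu>(x, A)\<^sup>2\<close>, so every
  \<open>\<nu>(x, \<cdot>)\<close> takes only the values 0 and 1. A Lusin space has a countable family of measurable sets
  separating its points; intersecting, for each member, whichever of it and its complement has
  measure 1 leaves a set of full measure with a single point \<open>T x\<close>. Measurability of \<open>T\<close>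
  follows from \<open>T\<inverse>(A) = {x. \<nu>(x, A) = 1}\<close>.
\<close>

definition separating_family :: "'a set \<Rightarrow> 'a set set \<Rightarrow> bool" where
  "separating_family S \<U> \<longleftrightarrow> (\<forall>x\<in>S. \<forall>y\<in>S. x \<noteq> y \<longrightarrow> (\<exists>U\<in>\<U>. x \<in> U \<and> y \<notin> U))"

text \<open>Compactness gives total boundedness, hence for every \<open>n\<close> a finite net of
  radius \<open>1 / Suc n\<close>. The balls around the points of all these nets are countably many
  open sets, and at a fine enough scale a ball around one point misses the other.\<close>

lemma compact_metrizable_separating_family:
  assumes "compact_space K" "metrizable_space K"
  obtains \<U> where "countable \<U>" "\<And>U. U \<in> \<U> \<Longrightarrow> openin K U" "separating_family (topspace K) \<U>"
proof -
  obtain S d where "Metric_space S d" and K: "K = Metric_space.mtopology S d"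
    using assms(2) by (auto simp: metrizable_space_def)
  interpret Metric_space S d by fact
  have top: "topspace K = S"
    by (simp add: K)
  have "mtotally_bounded S"
    using assms(1) compactin_imp_mtotally_bounded by (simp add: K compact_space_def)
  then have "\<exists>F. finite F \<and> F \<subseteq> S \<and> S \<subseteq> (\<Union>c\<in>F. mball c (1 / real (Suc n)))" for n
    by (simp add: mtotally_bounded_def)
  then obtain F where F: "\<And>n. finite (F n)" "\<And>n. S \<subseteq> (\<Union>c\<in>F n. mball c (1 / real (Suc n)))"
    by metis
  define \<U> where "\<U> = (\<Union>n. (\<lambda>c. mball c (1 / real (Suc n))) ` F n)"
  have "separating_family (topspace K) \<U>"
    unfolding separating_family_def top
  proof (intro ballI impI)
    fix x y assume xy: "x \<in> S" "y \<in> S" "x \<noteq> y"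
    then have "0 < d x y / 2"
      by simp
    \<comment> \<open>Two points of a ball are less than twice its radius apart, so a ball of radius
      below \<open>d x y / 2\<close> cannot contain both \<open>x\<close> and
      \<open>y\<close>.\<close>
    then obtain n where n: "1 / real (Suc n) < d x y / 2"
      by (metis nat_approx_posE)
    obtain c where c: "c \<in> F n" "x \<in> mball c (1 / real (Suc n))"
      using F(2) xy(1) by blast
    have "y \<notin> mball c (1 / real (Suc n))"
    proof
      assume y: "y \<in> mball c (1 / real (Suc n))"
      have "d x y \<le> d c x + d c y"
        using c(2) y by (metis commute in_mball triangle)
      also have "\<dots> < d x y"
        using c(2) y n by simp
      finally show False by simp
    qed
    with c show "\<exists>U\<in>\<U>. x \<in> U \<and> y \<notin> U"
      by (auto simp: \<U>_def)
  qed
  moreover have "countable \<U>"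
    using F(1) by (auto simp: \<U>_def intro: countable_finite)
  moreover have "openin K U" if "U \<in> \<U>" for U
    using that by (auto simp: \<U>_def K)
  ultimately show thesis
    using that by blast
qed

text \<open>The left inverse \<open>g\<close> makes \<open>f\<close> injective on
  \<open>space E\<close>, so taking preimages under \<open>f\<close> carries a separating family of
  open sets of \<open>K\<close> to a separating family of measurable sets of
  \<open>E\<close>.\<close>

lemma lusin_space_separating_family:
  assumes "lusin_space TYPE('k) E"
  obtains \<U> where "countable \<U>" "\<U> \<subseteq> sets E" "separating_family (space E) \<U>"
proof -
  obtain K :: "'k topology" and B where K: "compact_space K" "metrizable_space K"
    and iso: "measurable_isomorphic E (restrict_space (borel_of K) B)"
    using assms by (auto simp: lusin_space_def)
  obtain f g where f: "f \<in> E \<rightarrow>\<^sub>M restrict_space (borel_of K) B"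
    and gf: "\<And>x. x \<in> space E \<Longrightarrow> g (f x) = x"
    using iso unfolding measurable_isomorphic_def by blast
  \<comment> \<open>\<open>sigma\<close> has the intended space and sets only when its generators
    are subsets of the carrier.\<close>
  have sub: "{U. openin K U} \<subseteq> Pow (topspace K)"
    by (auto dest: openin_subset)
  have fK: "f \<in> E \<rightarrow>\<^sub>M borel_of K"
    using f by (simp add: measurable_restrict_space2_iff)
  have fx: "f x \<in> topspace K" if "x \<in> space E" for x
    using measurable_space[OF fK that] sub by (simp add: borel_of_def space_measure_of)
  obtain \<U> where \<U>: "countable \<U>" "\<And>U. U \<in> \<U> \<Longrightarrow> openin K U" "separating_family (topspace K) \<U>"
    using compact_metrizable_separating_family[OF K] by blast
  define \<V> where "\<V> = (\<lambda>U. f -` U \<inter> space E) ` \<U>"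
  have "\<V> \<subseteq> sets E"
  proof -
    have "U \<in> sets (borel_of K)" if "U \<in> \<U>" for U
      using sub \<U>(2)[OF that] by (auto simp: borel_of_def sets_measure_of)
    then show ?thesis
      using fK by (auto simp: \<V>_def measurable_sets)
  qed
  moreover have "separating_family (space E) \<V>"
    unfolding separating_family_def
  proof (intro ballI impI)
    fix x y assume xy: "x \<in> space E" "y \<in> space E" "x \<noteq> y"
    then have "f x \<noteq> f y"
      using gf by metis
    then obtain U where "U \<in> \<U>" "f x \<in> U" "f y \<notin> U"
      using \<U>(3) fx xy unfolding separating_family_def by blast
    then show "\<exists>V\<in>\<V>. x \<in> V \<and> y \<notin> V"
      using xy by (auto simp: \<V>_def)
  qed
  moreover have "countable \<V>"
    using \<U>(1) by (simp add: \<V>_def)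
  ultimately show thesis
    using that by blast
qed

lemma zero_one_measure_eq_return:
  assumes "prob_space \<mu>" and sets: "sets \<mu> = sets E"
    and zo: "\<And>A. A \<in> sets E \<Longrightarrow> measure \<mu> A = 0 \<or> measure \<mu> A = 1"
    and \<U>: "countable \<U>" "\<U> \<subseteq> sets E" "separating_family (space E) \<U>"
  shows "\<exists>t\<in>space E. \<mu> = return E t"
proof -
  interpret prob_space \<mu> by fact
  have sp: "space \<mu> = space E"
    using sets by (rule sets_eq_imp_space_eq)
  define V where "V U = (if prob U = 1 then U else space E - U)" for U
  have V: "V U \<in> events" "prob (V U) = 1" if "U \<in> \<U>" for U
    using that \<U>(2) zo[of U] prob_compl[of U] by (auto simp: V_def sets sp)
  define C where "C = space E \<inter> (\<Inter>U\<in>\<U>. V U)"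
  have AEV: "AE y in \<mu>. y \<in> V U" if "U \<in> \<U>" for U
    using V[OF that] by (simp add: prob_eq_1)
  \<comment> \<open>Countability of \<open>\<U>\<close> enters here: countably many almost sure
    events hold simultaneously almost surely.\<close>
  have AEC: "AE y in \<mu>. y \<in> C"
    using AEV \<U>(1) by (simp add: C_def AE_ball_countable sp[symmetric])
  have "C \<noteq> {}"
    using AEC AE_False by auto
  then obtain t where t: "t \<in> C"
    by blast
  \<comment> \<open>Each \<open>V U\<close> lies entirely on one side of \<open>U\<close>, so no
    member of \<open>\<U>\<close> can separate two points of \<open>C\<close>.\<close>
  have uniq: "y = t" if "y \<in> C" for y
  proof (rule ccontr)
    assume "y \<noteq> t"
    moreover have "y \<in> space E" "t \<in> space E"
      using that t by (simp_all add: C_def)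
    ultimately obtain U where U: "U \<in> \<U>" "y \<in> U" "t \<notin> U"
      using \<U>(3) unfolding separating_family_def by meson
    moreover have "y \<in> V U" "t \<in> V U"
      using U(1) that t by (simp_all add: C_def)
    ultimately show False
      by (simp add: V_def split: if_splits)
  qed
  have tE: "t \<in> space E"
    using t by (simp add: C_def)
  \<comment> \<open>The almost-everywhere form expresses concentration at \<open>t\<close> without a
    separate proof that the singleton is measurable.\<close>
  have AEt: "AE y in \<mu>. y = t"
    using AEC by eventually_elim (rule uniq)
  have "\<mu> = return E t"
  proof (rule measure_eqI)
    fix A assume A: "A \<in> sets \<mu>"
    show "emeasure \<mu> A = emeasure (return E t) A"
    proof (cases "t \<in> A")
      case True
      then have "AE y in \<mu>. y \<in> A"
        using AEt by auto
      then show ?thesis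
        using A True by (simp add: sets emeasure_eq_1_AE)
    next
      case False
      then have "AE y in \<mu>. y \<notin> A"
        using AEt by auto
      then have "emeasure \<mu> A = 0"
        using A emeasure_eq_0_AE[of "\<lambda>y. y \<in> A" \<mu>] sets.sets_into_space[OF A]
        by (simp add: Collect_conj_eq Int_absorb1)
      then show ?thesis
        using A False by (simp add: sets)
    qed
  qed (simp add: sets)
  with tE show ?thesis
    by blast
qed

lemma kernel_prob_space:
  assumes "\<nu> \<in> E \<rightarrow>\<^sub>M prob_algebra E" "x \<in> space E"
  shows "prob_space (\<nu> x)" "sets (\<nu> x) = sets E"
  using measurable_space[OF assms] by (auto simp: space_prob_algebra)

lemma indicator_in_Linfty:
  assumes "A \<in> sets E"
  shows "(\<lambda>y\<in>space E. indicator A y) \<in> Linfty E"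
proof -
  have "bounded ((\<lambda>y\<in>space E. indicator A y :: complex) ` space E)"
    by (rule boundedI[of _ 1]) (auto simp: indicator_def)
  moreover have "(\<lambda>y\<in>space E. indicator A y :: complex) \<in> borel_measurable E"
    using assms by (simp cong: measurable_cong)
  ultimately show ?thesis
    by (simp add: Linfty_def)
qed

lemma markov_op_indicator:
  assumes "\<nu> \<in> E \<rightarrow>\<^sub>M prob_algebra E" "A \<in> sets E" "x \<in> space E"
  shows "markov_op E \<nu> (\<lambda>y\<in>space E. indicator A y) x = of_real (measure (\<nu> x) A)"
proof -
  interpret prob_space "\<nu> x"
    using assms by (intro kernel_prob_space)
  have sets: "sets (\<nu> x) = sets E"
    using assms by (intro kernel_prob_space)
  have sp: "space (\<nu> x) = space E"
    using sets by (rule sets_eq_imp_space_eq)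
  have "(\<integral>y. (\<lambda>y\<in>space E. indicator A y :: complex) y \<partial>\<nu> x) = (\<integral>y. of_real (indicator A y) \<partial>\<nu> x)"
    by (intro Bochner_Integration.integral_cong) (auto simp: sp indicator_def)
  also have "\<dots> = of_real (measure (\<nu> x) A)"
    using assms by (simp add: sets integral_complex_of_real)
  finally show ?thesis
    using assms by (simp add: markov_op_def)
qed

lemma star_hom_imp_zero_one:
  assumes \<nu>: "\<nu> \<in> E \<rightarrow>\<^sub>M prob_algebra E" and hom: "star_hom E (markov_op E \<nu>)"
    and A: "A \<in> sets E" and x: "x \<in> space E"
  shows "measure (\<nu> x) A = 0 \<or> measure (\<nu> x) A = 1"
proof -
  define i :: "'a \<Rightarrow> complex" where "i = (\<lambda>y\<in>space E. indicator A y)"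
  have "i \<in> Linfty E"
    unfolding i_def using A by (rule indicator_in_Linfty)
  then have "markov_op E \<nu> (\<lambda>y\<in>space E. i y * i y) = (\<lambda>y\<in>space E. markov_op E \<nu> i y * markov_op E \<nu> i y)"
    using hom unfolding star_hom_def by blast
  \<comment> \<open>The indicator is an idempotent of the algebra, and so is its image under the
    operator. The equation holds for HOL functions because both sides are \<open>undefined\<close>
    off \<open>space E\<close>.\<close>
  moreover have "(\<lambda>y\<in>space E. i y * i y) = i"
    by (auto simp: i_def indicator_def)
  ultimately have "markov_op E \<nu> i = (\<lambda>y\<in>space E. markov_op E \<nu> i y * markov_op E \<nu> i y)"
    by simp
  from fun_cong[OF this, of x] have "markov_op E \<nu> i x = markov_op E \<nu> i x * markov_op E \<nu> i x"
    using x by simp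
  then have "measure (\<nu> x) A = measure (\<nu> x) A * measure (\<nu> x) A"
    unfolding i_def markov_op_indicator[OF \<nu> A x] by (metis of_real_eq_iff of_real_mult)
  then show ?thesis
    by simp
qed

lemma star_hom_imp_deterministic:
  assumes "lusin_space TYPE('k) E"
    and \<nu>: "\<nu> \<in> E \<rightarrow>\<^sub>M prob_algebra E" and hom: "star_hom E (markov_op E \<nu>)"
  shows "deterministic E \<nu>"
proof -
  obtain \<U> where \<U>: "countable \<U>" "\<U> \<subseteq> sets E" "separating_family (space E) \<U>"
    using lusin_space_separating_family[OF assms(1)] by blast
  have "\<forall>x\<in>space E. \<exists>t\<in>space E. \<nu> x = return E t"
    using zero_one_measure_eq_return[OF _ _ _ \<U>] kernel_prob_space[OF \<nu>]
      star_hom_imp_zero_one[OF \<nu> hom] by blast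
  then obtain T where T: "\<And>x. x \<in> space E \<Longrightarrow> T x \<in> space E" "\<And>x. x \<in> space E \<Longrightarrow> \<nu> x = return E (T x)"
    by metis
  have "T \<in> E \<rightarrow>\<^sub>M E"
  proof (rule measurableI)
    fix A assume A: "A \<in> sets E"
    have [measurable]: "(\<lambda>x. emeasure (\<nu> x) A) \<in> borel_measurable E"
      using measurable_prob_algebraD[OF \<nu>] A by (rule measurable_emeasure_kernel)
    \<comment> \<open>\<open>T\<close> was chosen pointwise, so its measurability has to come from
      the kernel: a Dirac mass gives \<open>A\<close> the value 1 exactly when its point lies in
      \<open>A\<close>.\<close>
    have "T -` A \<inter> space E = {x \<in> space E. emeasure (\<nu> x) A = 1}"
      using A by (auto simp: T(2) indicator_def split: if_splits)
    also have "\<dots> \<in> sets E"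
      by measurable
    finally show "T -` A \<inter> space E \<in> sets E" .
  qed (rule T(1))
  with T(2) show ?thesis
    by (auto simp: deterministic_def)
qed

text \<open>Integrating against the Dirac mass at \<open>T x\<close> evaluates at
  \<open>T x\<close>, so the operator is composition with \<open>T\<close>, which commutes with all
  pointwise operations.\<close>

lemma deterministic_imp_star_hom:
  assumes "deterministic E \<nu>"
  shows "star_hom E (markov_op E \<nu>)"
proof -
  obtain T where T: "T \<in> E \<rightarrow>\<^sub>M E" "\<And>x. x \<in> space E \<Longrightarrow> \<nu> x = return E (T x)"
    using assms by (auto simp: deterministic_def)
  have Tx: "T x \<in> space E" if "x \<in> space E" for x
    using T(1) that by (rule measurable_space)
  \<comment> \<open>Stated for restrictions of arbitrary measurable functions, this rewrites the
    operator on sums, products and conjugates directly, with only measurability to check. Elements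
    of \<open>Linfty E\<close> equal their own restrictions, which gives \<open>op'\<close>.\<close>
  have op: "markov_op E \<nu> (\<lambda>x\<in>space E. f x) = (\<lambda>x\<in>space E. f (T x))"
    if [measurable]: "f \<in> borel_measurable E" for f
  proof -
    have "(\<lambda>x\<in>space E. f x) \<in> borel_measurable E"
      by (simp cong: measurable_cong)
    then show ?thesis
      by (auto simp: markov_op_def T(2) Tx integral_return)
  qed
  have op': "markov_op E \<nu> f = (\<lambda>x\<in>space E. f (T x))" if "f \<in> Linfty E" for f
    using that op[of f] by (simp add: Linfty_def extensional_restrict)
  have meas: "f \<in> borel_measurable E" if "f \<in> Linfty E" for f
    using that by (simp add: Linfty_def)
  have "markov_op E \<nu> \<in> Linfty E \<rightarrow> Linfty E"
  proof
    fix f assume f: "f \<in> Linfty E"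
    have "(\<lambda>x. f (T x)) \<in> borel_measurable E"
      using T(1) meas[OF f] by (rule measurable_compose)
    then have "(\<lambda>x\<in>space E. f (T x)) \<in> borel_measurable E"
      by (simp cong: measurable_cong)
    moreover have "bounded ((\<lambda>x\<in>space E. f (T x)) ` space E)"
      using f Tx by (auto simp: Linfty_def elim!: bounded_subset)
    ultimately show "markov_op E \<nu> f \<in> Linfty E"
      unfolding op'[OF f] by (simp add: Linfty_def)
  qed
  \<comment> \<open>Conjugation is continuous, hence Borel; this is the side condition for using
    \<open>op\<close> on conjugates.\<close>
  moreover have "(\<lambda>x. cnj (f x)) \<in> borel_measurable E" if "f \<in> Linfty E" for f
    using meas[OF that] by (rule measurable_compose)
      (intro borel_measurable_continuous_onI continuous_intros)
  ultimately show ?thesis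
    unfolding star_hom_def
    by (auto simp: op op' meas borel_measurable_add borel_measurable_times cong: restrict_cong)
qed

theorem theorem2p6:
  fixes E :: "'a measure" and \<nu> :: "'a \<Rightarrow> 'a measure"
    and M :: "'w measure" and X :: "nat \<Rightarrow> 'w \<Rightarrow> 'a"
  assumes "lusin_space TYPE('k) E"
    and "markov_chain M E \<nu> X"
  shows "deterministic E \<nu> \<longleftrightarrow> star_hom E (markov_op E \<nu>)"
proof -
  have "\<nu> \<in> E \<rightarrow>\<^sub>M prob_algebra E"
    using assms(2) by (simp add: markov_chain_def)
  then show ?thesis
    using deterministic_imp_star_hom star_hom_imp_deterministic[OF assms(1)] by blast
qed

end
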